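(* For all integers $0\le k\le n$, $C_{n,k}=A_{n,k}(\widehat R_0,\ldots,\widehat R_{n-k})$.
   Context: $\mathbb{K}$ is a field of characteristic zero. Partial Bell polynomials: $B_{0,0}=1$, $B_{n,0}=0$ ($n\ge1$), $B_{n,k}=0$ ($k>n$), and for $1\le k\le n$, $B_{n,k}=\sum\frac{n!}{\prod_ir_i!(i!)^{r_i}}\prod_iX_i^{r_i}$ over non-negative integers with $\sum r_i=k$, $\sum ir_i=n$. $A_{n,k}\in\mathbb{K}[X_1^{-1},X_1,X_2,\ldots]$ is the unique lower triangular family with $A_{0,0}=1$, $A_{n,0}=0$ ($n\ge1$) and $\sum_{j=k}^nA_{n,j}B_{j,k}=\delta_{nk}$. Reciprocal polynomials: $\widehat R_m:=\sum_{i=0}^m(-1)^ii!X_0^{-(i+1)}B_{m,i}\in\mathbb{K}[X_0^{-1},X_1,\ldots,X_m]$. Comtet's polynomials $C_{n,k}\in\mathbb{K}[X_0,\ldots,X_{n-k}]$ are the triangular family determined by $C_{n,0}=\delta_{n0}$ and $C_{n+1,k}=X_0\big(C_{n,k-1}+\sum_{j=0}^{n-k}X_{j+1}\frac{\partial C_{n,k}}{\partial X_j}\big)$ (with $C_{n,-1}=0$, $C_{n,k}=0$ for $k>n$); equivalently they are the polynomials with $(\theta D)^n=\sum_{k=0}^nC_{n,k}(\theta,D\theta,D^2\theta,\ldots)\,D^k$ for all $\theta\in\mathbb{K}[[x]]$, $D$ the derivative. $P(H_0,H_1,\ldots)$ means substitution of $H_j$ for $X_{j+1}$ in $A_{n,k}$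 (i.e. $A_{n,k}$'s variables $X_1,X_2,\ldots$ are replaced by $\widehat R_0,\widehat R_1,\ldots$). *)

theory Defs
  imports Complex_Main "HOL-Library.Poly_Mapping"
begin

text \<open>
  Laurent polynomials over \<^typ>\<open>'a\<close> in the indeterminates $X_0, X_1, X_2, \ldots$: a monomial is a
  finitely supported family of integer exponents. All polynomials below are elements of this
  ring; the smaller rings they belong to are singled out by \<open>laurent_ring\<close>.
\<close>

type_synonym 'a laurent = "(nat \<Rightarrow>\<^sub>0 int) \<Rightarrow>\<^sub>0 'a"

definition Const :: "'a::comm_ring_1 \<Rightarrow> 'a laurent" where
  "Const c = Poly_Mapping.single 0 c"

definition Xpow :: "nat \<Rightarrow> int \<Rightarrow> 'a::comm_ring_1 laurent" where
  "Xpow i z = Poly_Mapping.single (Poly_Mapping.single i z) 1"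

abbreviation X :: "nat \<Rightarrow> 'a::comm_ring_1 laurent" where
  "X i \<equiv> Xpow i 1"

text \<open>\<open>laurent_ring V W\<close>: only the indeterminates $X_i$ with $i \in V$ occur, and among them only
  those with $i \in W$ may have negative exponents.\<close>

definition laurent_ring :: "nat set \<Rightarrow> nat set \<Rightarrow> 'a::comm_ring_1 laurent set" where
  "laurent_ring V W = {p. \<forall>m \<in> Poly_Mapping.keys p. Poly_Mapping.keys m \<subseteq> V \<and>
     (\<forall>i. i \<notin> W \<longrightarrow> Poly_Mapping.lookup m i \<ge> 0)}"

definition partial_deriv :: "nat \<Rightarrow> 'a::comm_ring_1 laurent \<Rightarrow> 'a laurent" where
  "partial_deriv i p = (\<Sum>m \<in> Poly_Mapping.keys p.
     Poly_Mapping.single (m - Poly_Mapping.single i 1)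
       (of_int (Poly_Mapping.lookup m i) * Poly_Mapping.lookup p m))"

text \<open>Integer powers in a commutative ring; for a negative exponent the base must be a unit.\<close>

definition unit_powi :: "'r::comm_ring_1 \<Rightarrow> int \<Rightarrow> 'r" where
  "unit_powi x z = (if z \<ge> 0 then x ^ nat z else (THE y. x * y = 1) ^ nat (- z))"

text \<open>Substitution of $f_i$ for $X_i$; meaningful if $f_i$ is a unit whenever $X_i$ occurs with a
  negative exponent.\<close>

definition laurent_subst :: "(nat \<Rightarrow> 'a::comm_ring_1 laurent) \<Rightarrow> 'a laurent \<Rightarrow> 'a laurent" where
  "laurent_subst f p = (\<Sum>m \<in> Poly_Mapping.keys p.
     Const (Poly_Mapping.lookup p m) *
     (\<Prod>i \<in> Poly_Mapping.keys m. unit_powi (f i) (Poly_Mapping.lookup m i)))"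

text \<open>Since $\sum_i i r_i = n$ forces $r_i = 0$ for $i > n$, families supported on
  $\{1, \ldots, n\}$ suffice.\<close>

definition bell_index :: "nat \<Rightarrow> nat \<Rightarrow> (nat \<Rightarrow> nat) set" where
  "bell_index n k = {r. (\<forall>i. i \<notin> {1..n} \<longrightarrow> r i = 0) \<and>
     (\<Sum>i = 1..n. r i) = k \<and> (\<Sum>i = 1..n. i * r i) = n}"

definition bell :: "nat \<Rightarrow> nat \<Rightarrow> 'a::field_char_0 laurent" where
  "bell n k =
    (if k = 0 then (if n = 0 then 1 else 0)
     else if k > n then 0
     else (\<Sum>r \<in> bell_index n k.
       Const (fact n / (\<Prod>i = 1..n. fact (r i) * fact i ^ r i)) * (\<Prod>i = 1..n. X i ^ r i)))"

definition is_bell_inverse :: "(nat \<Rightarrow> nat \<Rightarrow> 'a::field_char_0 laurent) \<Rightarrow> bool" where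
  "is_bell_inverse A \<longleftrightarrow>
     (\<forall>n k. A n k \<in> laurent_ring {1..} {1}) \<and>
     (\<forall>n k. k > n \<longrightarrow> A n k = 0) \<and>
     A 0 0 = 1 \<and> (\<forall>n \<ge> 1. A n 0 = 0) \<and>
     (\<forall>n k. k \<le> n \<longrightarrow> (\<Sum>j = k..n. A n j * bell j k) = (if n = k then 1 else 0))"

text \<open>The description is justified by \<open>is_bell_inverse_unique\<close> below.\<close>

definition bell_inverse :: "nat \<Rightarrow> nat \<Rightarrow> 'a::field_char_0 laurent" where
  "bell_inverse = (THE A. is_bell_inverse A)"

definition recip_poly :: "nat \<Rightarrow> 'a::field_char_0 laurent" where
  "recip_poly m = (\<Sum>i = 0..m. Const ((-1) ^ i * fact i) * Xpow 0 (- int (i + 1)) * bell m i)"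

fun comtet :: "nat \<Rightarrow> nat \<Rightarrow> 'a::field_char_0 laurent" where
  "comtet 0 k = (if k = 0 then 1 else 0)"
| "comtet (Suc n) 0 = 0"
| "comtet (Suc n) (Suc k) =
     X 0 * (comtet n k + (\<Sum>j \<in> {j. j + Suc k \<le> n}. X (Suc j) * partial_deriv j (comtet n (Suc k))))"

lemma Xpow_mult: "Xpow i a * Xpow i b = (Xpow i (a + b) :: 'a::comm_ring_1 laurent)"
  by (simp add: Xpow_def mult_single single_add)

lemma Xpow_0 [simp]: "Xpow i 0 = (1 :: 'a::comm_ring_1 laurent)"
  by (simp add: Xpow_def)

lemma X_power: "X i ^ k = (Xpow i (int k) :: 'a::comm_ring_1 laurent)"
  by (induction k) (simp_all add: Xpow_mult add.commute)

lemma laurent_ring_zero [simp]: "0 \<in> laurent_ring V W"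
  by (simp add: laurent_ring_def)

lemma laurent_ring_Const [simp]: "Const c \<in> laurent_ring V W"
  by (auto simp: laurent_ring_def Const_def)

lemma laurent_ring_one [simp]: "1 \<in> laurent_ring V W"
  by (auto simp: laurent_ring_def)

lemma laurent_ring_add: "p \<in> laurent_ring V W \<Longrightarrow> q \<in> laurent_ring V W \<Longrightarrow> p + q \<in> laurent_ring V W"
  unfolding laurent_ring_def using keys_add[of p q] by blast

lemma laurent_ring_uminus: "p \<in> laurent_ring V W \<Longrightarrow> - p \<in> laurent_ring V W"
  by (auto simp: laurent_ring_def)

lemma laurent_ring_diff: "p \<in> laurent_ring V W \<Longrightarrow> q \<in> laurent_ring V W \<Longrightarrow> p - q \<in> laurent_ring V W"
  using laurent_ring_add[of p V W "- q"] laurent_ring_uminus by fastforce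

lemma laurent_ring_mult:
  assumes "p \<in> laurent_ring V W" "q \<in> laurent_ring V W"
  shows "p * q \<in> laurent_ring V W"
proof -
  have "Poly_Mapping.keys m \<subseteq> V \<and> (\<forall>i. i \<notin> W \<longrightarrow> Poly_Mapping.lookup m i \<ge> 0)"
    if "m \<in> Poly_Mapping.keys (p * q)" for m
  proof -
    from that obtain a b where ab: "a \<in> Poly_Mapping.keys p" "b \<in> Poly_Mapping.keys q" "m = a + b"
      using keys_mult[of p q] by blast
    then show ?thesis
      using assms keys_add[of a b] by (fastforce simp: laurent_ring_def lookup_add)
  qed
  then show ?thesis by (simp add: laurent_ring_def)
qed

lemma laurent_ring_sum: "(\<And>i. i \<in> I \<Longrightarrow> f i \<in> laurent_ring V W) \<Longrightarrow> sum f I \<in> laurent_ring V W"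
  by (induction I rule: infinite_finite_induct) (auto intro: laurent_ring_add)

lemma laurent_ring_prod: "(\<And>i. i \<in> I \<Longrightarrow> f i \<in> laurent_ring V W) \<Longrightarrow> prod f I \<in> laurent_ring V W"
  by (induction I rule: infinite_finite_induct) (auto intro: laurent_ring_mult)

lemma laurent_ring_Xpow: "i \<in> V \<Longrightarrow> z \<ge> 0 \<or> i \<in> W \<Longrightarrow> Xpow i z \<in> laurent_ring V W"
  by (auto simp: laurent_ring_def Xpow_def lookup_single when_def)

lemma bell_in_laurent_ring: "bell n k \<in> laurent_ring {1..} W"
  by (auto simp: bell_def X_power
      intro!: laurent_ring_sum laurent_ring_mult laurent_ring_prod laurent_ring_Xpow)

lemma laurent_ring_mono: "p \<in> laurent_ring V W \<Longrightarrow> V \<subseteq> V' \<Longrightarrow> W \<subseteq> W' \<Longrightarrow> p \<in> laurent_ring V' W'"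
  unfolding laurent_ring_def by blast

lemma laurent_ring_partial_deriv:
  assumes "p \<in> laurent_ring V W"
  shows "partial_deriv i p \<in> laurent_ring V W"
  unfolding partial_deriv_def
proof (rule laurent_ring_sum)
  fix m assume "m \<in> Poly_Mapping.keys p"
  then have m: "Poly_Mapping.keys m \<subseteq> V" "\<And>j. j \<notin> W \<Longrightarrow> Poly_Mapping.lookup m j \<ge> 0"
    using assms by (auto simp: laurent_ring_def)
  show "Poly_Mapping.single (m - Poly_Mapping.single i 1)
      (of_int (Poly_Mapping.lookup m i) * Poly_Mapping.lookup p m) \<in> laurent_ring V W"
  proof (cases "Poly_Mapping.lookup m i = 0")
    case False
    then have "i \<in> V" using m(1) by (auto simp: in_keys_iff)
    then have "Poly_Mapping.keys (m - Poly_Mapping.single i 1) \<subseteq> V"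
      using m(1) keys_diff[of m "Poly_Mapping.single i 1"] by auto
    moreover have "Poly_Mapping.lookup (m - Poly_Mapping.single i 1) j \<ge> 0" if "j \<notin> W" for j
      using m(2)[OF that] False by (auto simp: lookup_minus lookup_single when_def)
    ultimately show ?thesis by (auto simp: laurent_ring_def)
  qed simp
qed

lemma comtet_in_laurent_ring: "(comtet n k :: 'a::field_char_0 laurent) \<in> laurent_ring {..n - k} {}"
proof (induction n k rule: comtet.induct)
  case (3 n k)
  have "X (Suc j) * partial_deriv j (comtet n (Suc k) :: 'a laurent) \<in> laurent_ring {..n - k} {}"
    if "j + Suc k \<le> n" for j
    using that laurent_ring_mono[OF 3(2)[of j], of "{..n - k}" "{}"] diff_le_mono2[of k "Suc k" n]
    by (intro laurent_ring_mult laurent_ring_partial_deriv laurent_ring_Xpow) auto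
  then have "(\<Sum>j \<in> {j. j + Suc k \<le> n}. X (Suc j) * partial_deriv j (comtet n (Suc k) :: 'a laurent))
      \<in> laurent_ring {..n - k} {}"
    by (intro laurent_ring_sum) auto
  with 3(1) show ?case
    by (auto intro!: laurent_ring_mult laurent_ring_add laurent_ring_Xpow)
qed auto

lemma comtet_eq_0: "k > n \<Longrightarrow> comtet n k = 0"
  by (induction n k rule: comtet.induct) auto

lemma bell_diag: "bell n n = (Xpow 1 (int n) :: 'a::field_char_0 laurent)"
proof (cases "n = 0")
  case False
  define r0 where "r0 = (\<lambda>i::nat. if i = 1 then n else 0)"
  have sub: "bell_index n n = {r0}"
  proof (intro set_eqI iffI)
    fix r assume "r \<in> bell_index n n"
    then have r: "\<And>i. i \<notin> {1..n} \<Longrightarrow> r i = 0" "(\<Sum>i = 1..n. r i) = n" "(\<Sum>i = 1..n. i * r i) = n"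
      by (auto simp: bell_index_def)
    have "(\<Sum>i = 1..n. i * r i) = (\<Sum>i = 1..n. r i + (i - 1) * r i)"
      by (intro sum.cong) (auto simp: algebra_simps diff_mult_distrib2)
    then have "(\<Sum>i = 1..n. (i - 1) * r i) = 0"
      using r by (simp add: sum.distrib)
    then have "(i - 1) * r i = 0" if "i \<in> {1..n}" for i
      using that by (meson finite_atLeastAtMost sum_eq_0_iff)
    then have z: "r i = 0" if "i \<noteq> 1" for i
      using that r(1)[of i] by (cases "i \<in> {1..n}") fastforce+
    have "(\<Sum>i = 1..n. r i) = (\<Sum>i \<in> {1}. r i)"
      using False z by (intro sum.mono_neutral_right) auto
    then show "r \<in> {r0}" using z r(2) by (auto simp: r0_def fun_eq_iff)
  next
    fix r assume "r \<in> {r0}"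
    then show "r \<in> bell_index n n"
      using False by (auto simp: bell_index_def r0_def if_distrib[of "(*) _"] cong: if_cong)
  qed
  have "(\<Prod>i = 1..n. fact (r0 i) * fact i ^ r0 i :: 'a) = (\<Prod>i \<in> {1}. fact (r0 i) * fact i ^ r0 i)"
    using False by (intro prod.mono_neutral_right) (auto simp: r0_def)
  moreover have "(\<Prod>i = 1..n. X i ^ r0 i :: 'a laurent) = (\<Prod>i \<in> {1}. X i ^ r0 i)"
    using False by (intro prod.mono_neutral_right) (auto simp: r0_def)
  ultimately show ?thesis
    using False by (simp add: bell_def sub) (simp add: r0_def X_power Const_def)
qed (simp add: bell_def)

lemma recip_poly_0_unit: "recip_poly 0 * X 0 = (1 :: 'a::field_char_0 laurent)"
  by (simp add: recip_poly_def bell_def Const_def Xpow_mult)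

lemma is_bell_inverse_rec:
  assumes "is_bell_inverse (A :: nat \<Rightarrow> nat \<Rightarrow> 'a::field_char_0 laurent)" "k \<le> n"
  shows "A n k = Xpow 1 (- int k) * ((if n = k then 1 else 0) - (\<Sum>j \<in> {k<..n}. A n j * bell j k))"
proof -
  have "(\<Sum>j = k..n. A n j * bell j k) = A n k * Xpow 1 (int k) + (\<Sum>j \<in> {k<..n}. A n j * bell j k)"
    using assms(2) by (simp add: sum.head bell_diag)
  then have "A n k * Xpow 1 (int k) = (if n = k then 1 else 0) - (\<Sum>j \<in> {k<..n}. A n j * bell j k)"
    using assms by (simp add: is_bell_inverse_def eq_diff_eq)
  then have "Xpow 1 (- int k) * (A n k * Xpow 1 (int k)) =
      Xpow 1 (- int k) * ((if n = k then 1 else 0) - (\<Sum>j \<in> {k<..n}. A n j * bell j k))"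
    by (simp only:)
  moreover have "Xpow 1 (- int k) * (A n k * Xpow 1 (int k)) = A n k"
    by (subst mult.left_commute) (simp add: Xpow_mult)
  ultimately show ?thesis by (simp only:)
qed

function bell_inverse_rec :: "nat \<Rightarrow> nat \<Rightarrow> 'a::field_char_0 laurent" where
  "bell_inverse_rec n k = (if k > n then 0 else
     Xpow 1 (- int k) *
       ((if n = k then 1 else 0) - (\<Sum>j \<in> {k<..n}. bell_inverse_rec n j * bell j k)))"
  by auto
termination by (relation "measure (\<lambda>(n, k). Suc n - k)") auto

declare bell_inverse_rec.simps [simp del]

lemma bell_inverse_rec_is_bell_inverse:
  "is_bell_inverse (bell_inverse_rec :: nat \<Rightarrow> nat \<Rightarrow> 'a::field_char_0 laurent)"
proof -
  let ?A = "bell_inverse_rec :: nat \<Rightarrow> nat \<Rightarrow> 'a laurent"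
  have mem: "?A n k \<in> laurent_ring {1..} {1}" for n k
  proof (induction n k rule: bell_inverse_rec.induct)
    case (1 n k)
    show ?case
    proof (cases "k > n")
      case True
      then show ?thesis by (subst bell_inverse_rec.simps) simp
    next
      case False
      have "(\<Sum>j \<in> {k<..n}. ?A n j * bell j k) \<in> laurent_ring {1..} {1}"
        using 1[OF False] by (intro laurent_ring_sum laurent_ring_mult bell_in_laurent_ring) auto
      then have "Xpow 1 (- int k) * ((if n = k then 1 else 0) - (\<Sum>j \<in> {k<..n}. ?A n j * bell j k))
          \<in> laurent_ring {1..} {1}"
        by (intro laurent_ring_mult laurent_ring_diff laurent_ring_Xpow) auto
      then show ?thesis using False
        by (subst bell_inverse_rec.simps) (simp only: if_False)
    qed
  qed
  have tri: "?A n k = 0" if "k > n" for n k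
    using that by (subst bell_inverse_rec.simps) simp
  have inv: "(\<Sum>j = k..n. ?A n j * bell j k) = (if n = k then 1 else 0)" if "k \<le> n" for n k
  proof -
    let ?S = "(\<Sum>j \<in> {k<..n}. ?A n j * bell j k)"
    have "(\<Sum>j = k..n. ?A n j * bell j k) = Xpow 1 (int k) * ?A n k + ?S"
      using that by (simp add: sum.head bell_diag mult.commute)
    also have "?A n k = Xpow 1 (- int k) * ((if n = k then 1 else 0) - ?S)"
      using that by (subst bell_inverse_rec.simps) simp
    also have "Xpow 1 (int k) * \<dots> + ?S = (if n = k then 1 else 0)"
      by (simp add: mult.assoc[symmetric] Xpow_mult)
    finally show ?thesis .
  qed
  have "?A n 0 = (if n = 0 then 1 else 0)" for n
  proof -
    have "(\<Sum>j = 0..n. ?A n j * bell j 0) = (\<Sum>j \<in> {0}. ?A n j * bell j 0)"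
      by (intro sum.mono_neutral_right) (auto simp: bell_def)
    then show ?thesis using inv[of 0 n] by (simp add: bell_def)
  qed
  with mem tri inv show ?thesis by (simp add: is_bell_inverse_def)
qed

lemma is_bell_inverse_unique:
  "\<exists>!A :: nat \<Rightarrow> nat \<Rightarrow> 'a::field_char_0 laurent. is_bell_inverse A"
proof (rule ex1I)
  show "is_bell_inverse (bell_inverse_rec :: nat \<Rightarrow> nat \<Rightarrow> 'a laurent)"
    by (rule bell_inverse_rec_is_bell_inverse)
next
  fix A :: "nat \<Rightarrow> nat \<Rightarrow> 'a laurent"
  assume A: "is_bell_inverse A"
  have "A n k = bell_inverse_rec n k" for n k
  proof (induction n k rule: bell_inverse_rec.induct)
    case (1 n k)
    show ?case
    proof (cases "k > n")
      case True
      then show ?thesis using A by (subst bell_inverse_rec.simps) (simp add: is_bell_inverse_def)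
    next
      case False
      with 1[OF False] have "(\<Sum>j \<in> {k<..n}. A n j * bell j k) = (\<Sum>j \<in> {k<..n}. bell_inverse_rec n j * bell j k)"
        by (intro sum.cong) auto
      with False is_bell_inverse_rec[OF A, of k n] show ?thesis
        by (subst bell_inverse_rec.simps) simp
    qed
  qed
  then show "A = bell_inverse_rec" by (simp add: fun_eq_iff)
qed

lemma is_bell_inverse_bell_inverse: "is_bell_inverse bell_inverse"
  unfolding bell_inverse_def by (rule theI'[OF is_bell_inverse_unique])

end

theory Submission imports Defs begin

text \<open>
  Let $D = \sum_j X_{j+1} \partial/\partial X_j$, the derivation with $D X_j = X_{j+1}$. Then
  $C_{n+1,k+1} = X_0 (C_{n,k} + D C_{n,k+1})$ and $B_{n+1,k+1} = X_1 B_{n,k} + D B_{n,k+1}$. The second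
  recursion gives $\widehat R_{m+1} = D \widehat R_m$, hence the substitution
  $X_{j+1} \mapsto \widehat R_j$ commutes with $D$, and the images $b_{n,k}$ of the Bell polynomials
  satisfy $b_{n+1,k+1} = X_0^{-1} b_{n,k} + D b_{n,k+1}$. Induction on $n$ with the Leibniz rule now
  yields $\sum_j C_{n,j} b_{j,k} = \delta_{nk}$, because the derivative of the right-hand side vanishes.
  The images of the $A_{n,k}$ satisfy the same triangular system, whose diagonal entries
  $b_{k,k} = X_0^{-k}$ are units.
\<close>

section \<open>Partial derivatives are derivations of the Laurent ring\<close>

text \<open>Reduces every additive or bilinear identity below to single monomials.\<close>

lemma poly_mapping_sum_keys:
  assumes "finite M" "Poly_Mapping.keys p \<subseteq> M"
  shows "p = (\<Sum>m\<in>M. Poly_Mapping.single m (Poly_Mapping.lookup p m))"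
proof (rule poly_mapping_eqI)
  fix m
  show "Poly_Mapping.lookup p m =
      Poly_Mapping.lookup (\<Sum>m\<in>M. Poly_Mapping.single m (Poly_Mapping.lookup p m)) m"
    using assms by (auto simp: lookup_sum lookup_single when_def in_keys_iff)
qed

text \<open>Monomials outside the support have coefficient 0. A common index set for several
  polynomials makes their derivatives comparable term by term.\<close>

lemma partial_deriv_superset:
  assumes "finite M" "Poly_Mapping.keys p \<subseteq> M"
  shows "partial_deriv i p = (\<Sum>m\<in>M. Poly_Mapping.single (m - Poly_Mapping.single i 1)
       (of_int (Poly_Mapping.lookup m i) * Poly_Mapping.lookup p m))"
  unfolding partial_deriv_def using assms
  by (intro sum.mono_neutral_left) (auto simp: in_keys_iff)

lemma partial_deriv_add: "partial_deriv i (p + q) = partial_deriv i p + partial_deriv i q"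
proof -
  let ?M = "Poly_Mapping.keys p \<union> Poly_Mapping.keys q"
  show ?thesis
    using keys_add[of p q]
    by (simp add: partial_deriv_superset[of ?M] sum.distrib[symmetric] lookup_add
        distrib_left single_add)
qed

lemma partial_deriv_zero [simp]: "partial_deriv i 0 = 0"
  by (simp add: partial_deriv_def)

lemma partial_deriv_single:
  "partial_deriv i (Poly_Mapping.single m c) =
    Poly_Mapping.single (m - Poly_Mapping.single i 1) (of_int (Poly_Mapping.lookup m i) * c)"
  by (simp add: partial_deriv_superset[of "{m}"])

lemma partial_deriv_sum: "partial_deriv i (\<Sum>x\<in>S. g x) = (\<Sum>x\<in>S. partial_deriv i (g x))"
  by (induction S rule: infinite_finite_induct) (simp_all add: partial_deriv_add)

text \<open>Both sides are bilinear, so monomials suffice; there the rule says that the exponents of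
  \<open>X i\<close> add up.\<close>

lemma partial_deriv_mult:
  "partial_deriv i (p * q) = partial_deriv i p * q + p * partial_deriv i q"
proof -
  have single: "partial_deriv i (Poly_Mapping.single a c * Poly_Mapping.single b d) =
      partial_deriv i (Poly_Mapping.single a c) * Poly_Mapping.single b d +
      Poly_Mapping.single a c * partial_deriv i (Poly_Mapping.single b d)"
    for a b and c d :: 'a
    by (simp add: mult_single partial_deriv_single lookup_add algebra_simps flip: single_add)
  let ?s = "\<lambda>p m. Poly_Mapping.single m (Poly_Mapping.lookup p m)"
  let ?P = "\<Sum>m\<in>Poly_Mapping.keys p. ?s p m" and ?Q = "\<Sum>m\<in>Poly_Mapping.keys q. ?s q m"
  have "partial_deriv i (?P * ?Q) = partial_deriv i ?P * ?Q + ?P * partial_deriv i ?Q"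
    by (simp add: sum_product partial_deriv_sum single sum.distrib)
  then show ?thesis
    by (simp flip: poly_mapping_sum_keys)
qed

lemma partial_deriv_eq_0:
  assumes "p \<in> laurent_ring V W" "i \<notin> V"
  shows "partial_deriv i p = 0"
proof -
  have "Poly_Mapping.lookup m i = 0" if "m \<in> Poly_Mapping.keys p" for m
  proof -
    have "Poly_Mapping.keys m \<subseteq> V" using that assms(1) by (auto simp: laurent_ring_def)
    then show ?thesis using assms(2) by (auto simp: in_keys_iff)
  qed
  then show ?thesis by (simp add: partial_deriv_def)
qed

section \<open>The derivation sending each indeterminate to the next one\<close>

definition vars :: "'a::comm_ring_1 laurent \<Rightarrow> nat set" where
  "vars p = (\<Union>m\<in>Poly_Mapping.keys p. Poly_Mapping.keys m)"

lemma finite_vars [simp]: "finite (vars p)"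
  by (simp add: vars_def)

lemma vars_subset: "p \<in> laurent_ring V W \<Longrightarrow> vars p \<subseteq> V"
  by (auto simp: vars_def laurent_ring_def)

lemma laurent_ring_vars: "p \<in> laurent_ring (vars p) UNIV"
  by (auto simp: vars_def laurent_ring_def)

text \<open>Models d/dx when \<open>X j\<close> stands for the j-th derivative of a function.
  Restricting to \<open>vars p\<close> keeps the sum finite.\<close>

definition total_deriv :: "'a::comm_ring_1 laurent \<Rightarrow> 'a laurent" where
  "total_deriv p = (\<Sum>j\<in>vars p. X (Suc j) * partial_deriv j p)"

lemma total_deriv_superset:
  assumes "finite M" "vars p \<subseteq> M"
  shows "total_deriv p = (\<Sum>j\<in>M. X (Suc j) * partial_deriv j p)"
  unfolding total_deriv_def using assms
  by (intro sum.mono_neutral_left) (auto simp: partial_deriv_eq_0[OF laurent_ring_vars])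

lemma total_deriv_zero [simp]: "total_deriv 0 = 0"
  by (simp add: total_deriv_def)

lemma total_deriv_add: "total_deriv (p + q) = total_deriv p + total_deriv q"
proof -
  let ?M = "vars p \<union> vars q \<union> vars (p + q)"
  have "total_deriv r = (\<Sum>j\<in>?M. X (Suc j) * partial_deriv j r)" if "r \<in> {p, q, p + q}" for r
    using that by (intro total_deriv_superset) auto
  then show ?thesis
    by (simp add: partial_deriv_add distrib_left sum.distrib)
qed

lemma total_deriv_sum: "total_deriv (\<Sum>x\<in>S. g x) = (\<Sum>x\<in>S. total_deriv (g x))"
  by (induction S rule: infinite_finite_induct) (simp_all add: total_deriv_add)

lemma total_deriv_mult: "total_deriv (p * q) = total_deriv p * q + p * total_deriv q"
proof -
  let ?M = "vars p \<union> vars q \<union> vars (p * q)"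
  have "total_deriv r = (\<Sum>j\<in>?M. X (Suc j) * partial_deriv j r)" if "r \<in> {p, q, p * q}" for r
    using that by (intro total_deriv_superset) auto
  then show ?thesis
    by (simp add: partial_deriv_mult distrib_left sum.distrib sum_distrib_left sum_distrib_right
        mult_ac)
qed

lemma total_deriv_Const [simp]: "total_deriv (Const c) = 0"
  using total_deriv_superset[of "{}" "Const c"] vars_subset[OF laurent_ring_Const, of c "{}"]
  by simp

lemma total_deriv_one [simp]: "total_deriv 1 = 0"
  using total_deriv_Const[of 1] by (simp add: Const_def)

lemma total_deriv_Xpow:
  "total_deriv (Xpow i z) = Const (of_int z) * X (Suc i) * Xpow i (z - 1)"
proof -
  have "vars (Xpow i z :: 'a laurent) \<subseteq> {i}"
    by (intro vars_subset[where W = UNIV] laurent_ring_Xpow) auto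
  then have "total_deriv (Xpow i z :: 'a laurent) = X (Suc i) * partial_deriv i (Xpow i z)"
    by (simp add: total_deriv_superset[of "{i}"])
  also have "\<dots> = Const (of_int z) * X (Suc i) * Xpow i (z - 1)"
    by (simp add: Xpow_def Const_def partial_deriv_single mult_single single_diff add_diff_eq
        del: single_of_int)
  finally show ?thesis .
qed

lemma total_deriv_X [simp]: "total_deriv (X i) = X (Suc i)"
  by (simp add: total_deriv_Xpow Const_def)

text \<open>The index set has the form \<open>{l..}\<close> because it must be closed under the
  shift from j to j + 1.\<close>

lemma laurent_ring_total_deriv:
  assumes "p \<in> laurent_ring {l..} W"
  shows "total_deriv p \<in> laurent_ring {l..} W"
  unfolding total_deriv_def using vars_subset[OF assms]
  by (intro laurent_ring_sum laurent_ring_mult laurent_ring_partial_deriv[OF assms]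
      laurent_ring_Xpow) auto

text \<open>\<open>comtet n (Suc k)\<close> involves only X_0, ..., X_(n-k-1), exactly the range of
  the sum in the definition of \<open>comtet\<close>, so that sum is the full derivation.\<close>

lemma comtet_Suc_Suc:
  "(comtet (Suc n) (Suc k) :: 'a::field_char_0 laurent) =
    X 0 * (comtet n k + total_deriv (comtet n (Suc k)))"
proof (cases "Suc k \<le> n")
  case True
  have "{j. j + Suc k \<le> n} = {..n - Suc k}" using True by auto
  moreover have "vars (comtet n (Suc k) :: 'a laurent) \<subseteq> {..n - Suc k}"
    by (rule vars_subset[OF comtet_in_laurent_ring])
  ultimately show ?thesis
    by (simp add: total_deriv_superset[of "{..n - Suc k}"])
next
  \<comment> \<open>Here the subtraction \<open>n - Suc k\<close> truncates, but the differentiated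
    polynomial is 0.\<close>
  case False
  then show ?thesis by (simp add: comtet_eq_0)
qed

lemma comtet_0_right: "comtet n 0 = (if n = 0 then 1 else 0)"
  by (cases n) auto

section \<open>Substitution as a ring homomorphism compatible with the derivation\<close>

lemma unit_inverse_unique:
  fixes x y :: "'r::comm_ring_1"
  assumes "x * y = 1"
  shows "(THE y. x * y = 1) = y"
proof (rule the_equality)
  show "x * y = 1" by (fact assms)
next
  fix z assume "x * z = 1"
  then have "z = (x * y) * z" "y = (x * z) * y" using assms by simp_all
  then show "z = y" by (simp add: mult_ac)
qed

text \<open>If both exponents are nonnegative, this is the law for natural powers. Otherwise x has
  an inverse y, and writing exponents as differences of naturals avoids a case analysis on
  signs.\<close>

lemma unit_powi_add:
  fixes x :: "'r::comm_ring_1"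
  assumes "x dvd 1 \<or> a \<ge> 0 \<and> b \<ge> 0"
  shows "unit_powi x (a + b) = unit_powi x a * unit_powi x b"
proof (cases "a \<ge> 0 \<and> b \<ge> 0")
  case True
  then show ?thesis by (simp add: unit_powi_def nat_add_distrib power_add)
next
  case False
  with assms obtain y where y: "x * y = 1" by (metis dvdE)
  have cancel: "x ^ (m + l) * y ^ l = x ^ m" "x ^ m * y ^ (m + l) = y ^ l" for m l
  proof -
    have one: "x ^ i * y ^ i = 1" for i
      using y by (simp flip: power_mult_distrib)
    show "x ^ (m + l) * y ^ l = x ^ m"
      by (simp add: power_add mult.assoc one)
    show "x ^ m * y ^ (m + l) = y ^ l"
      by (simp add: power_add one flip: mult.assoc)
  qed
  \<comment> \<open>The value does not depend on which difference m - l represents the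
    exponent.\<close>
  have shift: "unit_powi x (int m - int l) = x ^ m * y ^ l" for m l
  proof (cases "l \<le> m")
    case True
    then obtain d where "m = d + l" by (metis add.commute le_Suc_ex)
    then show ?thesis by (simp add: unit_powi_def cancel)
  next
    case False
    then obtain d where "l = m + d" by (metis le_Suc_ex nat_le_linear)
    with False show ?thesis
      by (simp add: unit_powi_def cancel unit_inverse_unique[OF y])
  qed
  obtain m l m' l' where ab: "a = int m - int l" "b = int m' - int l'"
    by (metis int_diff_cases)
  then have "a + b = int (m + m') - int (l + l')" by simp
  then have "unit_powi x (a + b) = x ^ (m + m') * y ^ (l + l')" by (simp only: shift)
  then show ?thesis by (simp add: ab shift power_add mult_ac)
qed

lemma unit_powi_0 [simp]: "unit_powi x 0 = 1"
  by (simp add: unit_powi_def)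

lemma prod_unit_powi_superset:
  assumes "finite I" "Poly_Mapping.keys m \<subseteq> I"
  shows "(\<Prod>i\<in>Poly_Mapping.keys m. unit_powi (f i) (Poly_Mapping.lookup m i)) =
    (\<Prod>i\<in>I. unit_powi (f i) (Poly_Mapping.lookup m i))"
  using assms by (intro prod.mono_neutral_left) (auto simp: in_keys_iff)

lemma Const_add: "Const (a + b) = Const a + Const b"
  by (simp add: Const_def single_add)

lemma Const_mult: "Const (a * b) = Const a * Const b"
  by (simp add: Const_def mult_single)

lemma Const_0 [simp]: "Const 0 = 0"
  by (simp add: Const_def)

lemma Const_1 [simp]: "Const 1 = 1"
  by (simp add: Const_def)

lemma Const_of_nat: "Const (of_nat n) = of_nat n"
  by (simp add: Const_def)

lemma laurent_subst_superset:
  assumes "finite M" "Poly_Mapping.keys p \<subseteq> M"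
  shows "laurent_subst f p = (\<Sum>m\<in>M. Const (Poly_Mapping.lookup p m) *
     (\<Prod>i \<in> Poly_Mapping.keys m. unit_powi (f i) (Poly_Mapping.lookup m i)))"
  unfolding laurent_subst_def using assms
  by (intro sum.mono_neutral_left) (auto simp: in_keys_iff)

lemma laurent_subst_add: "laurent_subst f (p + q) = laurent_subst f p + laurent_subst f q"
proof -
  let ?M = "Poly_Mapping.keys p \<union> Poly_Mapping.keys q"
  show ?thesis
    using keys_add[of p q]
    by (simp add: laurent_subst_superset[of ?M] sum.distrib[symmetric] lookup_add
        distrib_right Const_add)
qed

lemma laurent_subst_zero [simp]: "laurent_subst f 0 = 0"
  by (simp add: laurent_subst_def)

lemma laurent_subst_sum: "laurent_subst f (\<Sum>x\<in>S. g x) = (\<Sum>x\<in>S. laurent_subst f (g x))"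
  by (induction S rule: infinite_finite_induct) (simp_all add: laurent_subst_add)

lemma laurent_subst_single:
  "laurent_subst f (Poly_Mapping.single m c) =
    Const c * (\<Prod>i \<in> Poly_Mapping.keys m. unit_powi (f i) (Poly_Mapping.lookup m i))"
  by (simp add: laurent_subst_superset[of "{m}"])

lemma laurent_subst_Const [simp]: "laurent_subst f (Const c) = Const c"
  by (simp add: Const_def laurent_subst_single)

lemma laurent_subst_one [simp]: "laurent_subst f 1 = 1"
  using laurent_subst_Const[of f 1] by simp

lemma laurent_subst_X [simp]: "laurent_subst f (X i) = f i"
  by (simp add: Xpow_def laurent_subst_single unit_powi_def)

text \<open>On monomials exponents add, so \<open>unit_powi_add\<close> applies index by index.
  Negative exponents are confined to W, whose indeterminates go to units; bilinearity gives the
  rest.\<close>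

lemma laurent_subst_mult:
  assumes p: "p \<in> laurent_ring V W" and q: "q \<in> laurent_ring V W"
    and unit: "\<And>i. i \<in> W \<Longrightarrow> f i dvd 1"
  shows "laurent_subst f (p * q) = laurent_subst f p * laurent_subst f q"
proof -
  let ?s = "\<lambda>p m. Poly_Mapping.single m (Poly_Mapping.lookup p m)"
  have single: "laurent_subst f (?s p a * ?s q b) = laurent_subst f (?s p a) * laurent_subst f (?s q b)"
    if "a \<in> Poly_Mapping.keys p" "b \<in> Poly_Mapping.keys q" for a b
  proof -
    let ?I = "Poly_Mapping.keys a \<union> Poly_Mapping.keys b"
    have "f i dvd 1 \<or> Poly_Mapping.lookup a i \<ge> 0 \<and> Poly_Mapping.lookup b i \<ge> 0" for i
      using that p q unit[of i] unfolding laurent_ring_def by blast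
    then have "(\<Prod>i\<in>?I. unit_powi (f i) (Poly_Mapping.lookup (a + b) i)) =
        (\<Prod>i\<in>?I. unit_powi (f i) (Poly_Mapping.lookup a i)) *
        (\<Prod>i\<in>?I. unit_powi (f i) (Poly_Mapping.lookup b i))"
      by (simp add: lookup_add unit_powi_add prod.distrib)
    then show ?thesis
      using keys_add[of a b] prod_unit_powi_superset[of ?I a f] prod_unit_powi_superset[of ?I b f]
        prod_unit_powi_superset[of ?I "a + b" f]
      by (simp add: mult_single laurent_subst_single Const_mult mult_ac)
  qed
  let ?P = "\<Sum>m\<in>Poly_Mapping.keys p. ?s p m" and ?Q = "\<Sum>m\<in>Poly_Mapping.keys q. ?s q m"
  have "laurent_subst f (?P * ?Q) = laurent_subst f ?P * laurent_subst f ?Q"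
    by (simp add: sum_product laurent_subst_sum single)
  then show ?thesis
    by (simp flip: poly_mapping_sum_keys)
qed

lemma laurent_subst_power:
  assumes "p \<in> laurent_ring V {}"
  shows "laurent_subst f (p ^ n) = laurent_subst f p ^ n"
proof -
  \<comment> \<open>Membership is carried through the induction because multiplicativity demands it
    of both factors.\<close>
  have "p ^ n \<in> laurent_ring V {} \<and> laurent_subst f (p ^ n) = laurent_subst f p ^ n"
  proof (induction n)
    case (Suc n)
    then have "laurent_subst f (p * p ^ n) = laurent_subst f p * laurent_subst f (p ^ n)"
      by (intro laurent_subst_mult[OF assms]) auto
    with Suc assms show ?case by (simp add: laurent_ring_mult)
  qed simp
  then show ?thesis ..
qed

lemma prod_X_power:
  "(\<Prod>i\<in>S. X i ^ r i) =
    Poly_Mapping.single (\<Sum>i\<in>S. Poly_Mapping.single i (int (r i))) (1 :: 'a::comm_ring_1)"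
  unfolding X_power
  by (induction S rule: infinite_finite_induct) (simp_all add: Xpow_def mult_single)

text \<open>The hypothesis on f is the claim for the generators \<open>X i\<close>. By the Leibniz
  rule it passes to products, hence to monomials, and by additivity to all polynomials.\<close>

lemma laurent_subst_total_deriv:
  assumes p: "p \<in> laurent_ring {l..} {}"
    and f: "\<And>i. i \<ge> l \<Longrightarrow> f (Suc i) = total_deriv (f i)"
  shows "laurent_subst f (total_deriv p) = total_deriv (laurent_subst f p)"
proof -
  \<comment> \<open>Membership in the polynomial ring belongs to G so that substitution is
    multiplicative on the factors and on their derivatives.\<close>
  define G where "G = {q \<in> laurent_ring {l..} {}.
    laurent_subst f (total_deriv q) = total_deriv (laurent_subst f q)}"
  have G_mult: "q * q' \<in> G" if "q \<in> G" "q' \<in> G" for q q'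
  proof -
    have mult: "laurent_subst f (u * v) = laurent_subst f u * laurent_subst f v"
      if "u \<in> laurent_ring {l..} {}" "v \<in> laurent_ring {l..} {}" for u v
      using that by (rule laurent_subst_mult) simp
    show ?thesis
      using that by (simp add: G_def total_deriv_mult laurent_subst_add laurent_ring_mult mult
          laurent_ring_total_deriv)
  qed
  have G_one: "1 \<in> G" by (simp add: G_def)
  have G_power: "q ^ e \<in> G" if "q \<in> G" for q e
    using that by (induction e) (simp_all add: G_one G_mult)
  have G_prod: "prod g S \<in> G" if "\<And>i. i \<in> S \<Longrightarrow> g i \<in> G" for g and S :: "nat set"
    using that by (induction S rule: infinite_finite_induct) (simp_all add: G_one G_mult)
  have G_X: "X i \<in> G" if "i \<ge> l" for i
    using that by (simp add: G_def laurent_ring_Xpow f)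
  have G_monomial: "Poly_Mapping.single m (Poly_Mapping.lookup p m) \<in> G"
    if m: "m \<in> Poly_Mapping.keys p" for m
  proof -
    have m_keys: "Poly_Mapping.keys m \<subseteq> {l..}" and nonneg: "\<And>i. Poly_Mapping.lookup m i \<ge> 0"
      using m p by (auto simp: laurent_ring_def)
    let ?e = "\<lambda>i. nat (Poly_Mapping.lookup m i)"
    have "(\<Sum>i\<in>Poly_Mapping.keys m. Poly_Mapping.single i (int (?e i))) = m"
      using poly_mapping_sum_keys[of "Poly_Mapping.keys m" m] nonneg by simp
    then have "Poly_Mapping.single m (Poly_Mapping.lookup p m) =
        Const (Poly_Mapping.lookup p m) * (\<Prod>i\<in>Poly_Mapping.keys m. X i ^ ?e i)"
      by (simp add: prod_X_power Const_def mult_single)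
    moreover have "Const c \<in> G" for c by (simp add: G_def)
    moreover have "(\<Prod>i\<in>Poly_Mapping.keys m. X i ^ ?e i) \<in> G"
      using m_keys by (intro G_prod G_power G_X) auto
    ultimately show ?thesis by (simp add: G_mult)
  qed
  let ?P = "\<Sum>m\<in>Poly_Mapping.keys p. Poly_Mapping.single m (Poly_Mapping.lookup p m)"
  have "laurent_subst f (total_deriv ?P) = total_deriv (laurent_subst f ?P)"
    using G_monomial by (simp add: total_deriv_sum laurent_subst_sum G_def)
  then show ?thesis
    by (simp flip: poly_mapping_sum_keys)
qed

section \<open>The differential recursion of the partial Bell polynomials\<close>

text \<open>The truncation level \<open>N\<close> of the indices is kept independent of \<open>n\<close>, so that index sets for
  different \<open>n\<close> can be compared.\<close>

definition type_index :: "nat \<Rightarrow> nat \<Rightarrow> nat \<Rightarrow> (nat \<Rightarrow> nat) set" where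
  "type_index N n k = {r. (\<forall>i. i \<notin> {1..N} \<longrightarrow> r i = 0) \<and>
     (\<Sum>i = 1..N. r i) = k \<and> (\<Sum>i = 1..N. i * r i) = n}"

text \<open>The summand of \<open>bell n k\<close> at r without the factor n!, so that it no longer
  depends on n; a single monomial is easy to differentiate.\<close>

definition bell_weight :: "nat \<Rightarrow> (nat \<Rightarrow> nat) \<Rightarrow> 'a::field_char_0 laurent" where
  "bell_weight N r = Poly_Mapping.single (\<Sum>i = 1..N. Poly_Mapping.single i (int (r i)))
     (1 / (\<Prod>i = 1..N. fact (r i) * fact i ^ r i))"

lemma type_index_le:
  assumes "r \<in> type_index N n k" "i \<in> {1..N}"
  shows "i * r i \<le> n"
proof -
  have "i * r i \<le> (\<Sum>i = 1..N. i * r i)"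
    using assms(2) by (intro member_le_sum) auto
  then show ?thesis using assms(1) by (simp add: type_index_def)
qed

lemma type_index_eq_0:
  assumes "r \<in> type_index N n k" "n < i"
  shows "r i = 0"
proof (cases "i \<in> {1..N}")
  case True
  then have "i * r i < i * 1" using type_index_le[OF assms(1) True] assms(2) by linarith
  then show ?thesis by simp
next
  case False
  then show ?thesis using assms(1) by (simp add: type_index_def)
qed

lemma finite_type_index [simp]: "finite (type_index N n k)"
proof (rule finite_subset)
  show "finite {r. \<forall>i. (i \<in> {1..N} \<longrightarrow> r i \<in> {..n}) \<and> (i \<notin> {1..N} \<longrightarrow> r i = 0)}"
    by (intro finite_set_of_finite_funs) auto
  show "type_index N n k \<subseteq> {r. \<forall>i. (i \<in> {1..N} \<longrightarrow> r i \<in> {..n}) \<and> (i \<notin> {1..N} \<longrightarrow> r i = 0)}"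
  proof clarify
    fix r i assume r: "r \<in> type_index N n k"
    have "r i \<le> n" if "i \<in> {1..N}"
    proof -
      have "r i \<le> i * r i" using that by simp
      then show ?thesis using type_index_le[OF r that] by (rule order_trans)
    qed
    then show "(i \<in> {1..N} \<longrightarrow> r i \<in> {..n}) \<and> (i \<notin> {1..N} \<longrightarrow> r i = 0)"
      using r by (simp add: type_index_def)
  qed
qed

text \<open>View r as the type of a set partition, with r i blocks of size i. Blocks larger than n
  cannot occur, so a higher truncation level adds only zeros.\<close>

lemma type_index_eq_bell_index:
  assumes "n \<le> N"
  shows "type_index N n k = bell_index n k"
proof -
  have eq: "(\<Sum>i = 1..N. g i (r i)) = (\<Sum>i = 1..n. g i (r i))"
    if "\<And>i. i \<notin> {1..n} \<Longrightarrow> r i = 0" "\<And>i. g i 0 = 0" for r :: "nat \<Rightarrow> nat" and g :: "nat \<Rightarrow> nat \<Rightarrow> nat"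
    using assms that by (intro sum.mono_neutral_right) auto
  show ?thesis
  proof (intro set_eqI iffI)
    fix r assume r: "r \<in> type_index N n k"
    have "r i = 0" if "i \<notin> {1..n}" for i
    proof (cases "i = 0")
      case True
      then show ?thesis using r by (simp add: type_index_def)
    next
      case False
      then show ?thesis using that by (intro type_index_eq_0[OF r]) auto
    qed
    then show "r \<in> bell_index n k"
      using r eq[of r "\<lambda>i x. x"] eq[of r "(*)"] by (simp add: type_index_def bell_index_def)
  next
    fix r assume r: "r \<in> bell_index n k"
    then have "r i = 0" if "i \<notin> {1..n}" for i
      using that by (simp add: bell_index_def)
    then show "r \<in> type_index N n k"
      using r eq[of r "\<lambda>i x. x"] eq[of r "(*)"] assms by (auto simp: type_index_def bell_index_def)
  qed
qed

text \<open>Every block has at least one element.\<close>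

lemma type_index_empty:
  assumes "n < k"
  shows "type_index N n k = {}"
proof -
  have "k \<le> n" if "r \<in> type_index N n k" for r
  proof -
    have "(\<Sum>i = 1..N. 1 * r i) \<le> (\<Sum>i = 1..N. i * r i)"
      by (intro sum_mono mult_right_mono) auto
    then show ?thesis using that by (simp add: type_index_def)
  qed
  then show ?thesis using assms by fastforce
qed

lemma type_index_0: "type_index N n 0 = (if n = 0 then {\<lambda>_. 0} else {})"
proof -
  have "r = (\<lambda>_. 0)" if "r \<in> type_index N n 0" for r
    using that by (force simp: type_index_def fun_eq_iff)
  then have "type_index N n 0 \<subseteq> {\<lambda>_. 0}" by blast
  moreover have "(\<lambda>_. 0) \<in> type_index N n 0 \<longleftrightarrow> n = 0" by (auto simp: type_index_def)
  ultimately show ?thesis by (auto simp: subset_singleton_iff)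
qed

text \<open>Brings Bell polynomials with different n to the same weights. The special cases in
  \<open>bell\<close> agree with the index sets: one zero family for n = k = 0, none for k = 0 < n
  or k > n.\<close>

lemma bell_eq_sum_weights:
  assumes "n \<le> N"
  shows "(bell n k :: 'a::field_char_0 laurent) =
    Const (fact n) * (\<Sum>r\<in>type_index N n k. bell_weight N r)"
proof -
  consider "k = 0" | "k > n" | "k \<noteq> 0" "k \<le> n" by linarith
  then show ?thesis
  proof cases
    case 1
    then show ?thesis by (simp add: bell_def type_index_0 bell_weight_def)
  next
    case 2
    then show ?thesis by (simp add: bell_def type_index_empty)
  next
    case 3
    have "Const (fact n / (\<Prod>i = 1..n. fact (r i) * fact i ^ r i)) * (\<Prod>i = 1..n. X i ^ r i) =
        Const (fact n) * (bell_weight N r :: 'a laurent)" if "r \<in> bell_index n k" for r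
    proof -
      have 0: "r i = 0" if "i \<notin> {1..n}" for i
        using that \<open>r \<in> bell_index n k\<close> by (simp add: bell_index_def)
      have "(\<Prod>i = 1..n. fact (r i) * fact i ^ r i :: 'a) = (\<Prod>i = 1..N. fact (r i) * fact i ^ r i)"
        using 0 assms by (intro prod.mono_neutral_left) auto
      moreover have "(\<Prod>i = 1..n. X i ^ r i :: 'a laurent) = (\<Prod>i = 1..N. X i ^ r i)"
        using 0 assms by (intro prod.mono_neutral_left) auto
      ultimately show ?thesis
        by (simp add: bell_weight_def prod_X_power Const_def mult_single)
    qed
    with 3 show ?thesis
      by (simp add: bell_def type_index_eq_bell_index[OF assms] sum_distrib_left)
  qed
qed

lemma raise_sums:
  assumes "i \<in> {1..N}"
  shows "(\<Sum>j = 1..N. (t(i := Suc (t i))) j) = Suc (\<Sum>j = 1..N. t j)"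
    and "(\<Sum>j = 1..N. j * (t(i := Suc (t i))) j) = (\<Sum>j = 1..N. j * t j) + i"
proof -
  have rest: "(\<Sum>j\<in>{1..N} - {i}. g j ((t(i := Suc (t i))) j)) = (\<Sum>j\<in>{1..N} - {i}. g j (t j))"
    for g :: "nat \<Rightarrow> nat \<Rightarrow> nat"
    by (intro sum.cong) auto
  show "(\<Sum>j = 1..N. (t(i := Suc (t i))) j) = Suc (\<Sum>j = 1..N. t j)"
    and "(\<Sum>j = 1..N. j * (t(i := Suc (t i))) j) = (\<Sum>j = 1..N. j * t j) + i"
    using rest[of "\<lambda>j x. x"] rest[of "(*)"]
    by (simp_all only: sum.remove[OF finite_atLeastAtMost assms]) simp_all
qed

text \<open>Removing one block of size i is a bijection from the types that have such a block; F
  vanishes on the others.\<close>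

lemma sum_type_index_raise:
  assumes i: "i \<in> {1..N}" and F: "\<And>r. r i = 0 \<Longrightarrow> F r = 0"
  shows "(\<Sum>r\<in>type_index N (n + i) (Suc k). F r) = (\<Sum>t\<in>type_index N n k. F (t(i := Suc (t i))))"
proof -
  have raise: "t(i := Suc (t i)) \<in> type_index N (n + i) (Suc k) \<longleftrightarrow> t \<in> type_index N n k" for t
    using i raise_sums[OF i, of t] by (auto simp: type_index_def)
  have "(\<Sum>r\<in>type_index N (n + i) (Suc k). F r) =
      (\<Sum>r\<in>{r \<in> type_index N (n + i) (Suc k). r i \<noteq> 0}. F r)"
    using F by (intro sum.mono_neutral_right) auto
  also have "\<dots> = (\<Sum>t\<in>type_index N n k. F (t(i := Suc (t i))))"
  proof (rule sum.reindex_bij_witness[of _ "\<lambda>t. t(i := Suc (t i))" "\<lambda>r. r(i := r i - 1)"])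
    fix r assume r: "r \<in> {r \<in> type_index N (n + i) (Suc k). r i \<noteq> 0}"
    then show "(r(i := r i - 1))(i := Suc ((r(i := r i - 1)) i)) = r" by auto
    with r show "r(i := r i - 1) \<in> type_index N n k"
      using raise[of "r(i := r i - 1)"] by simp
    show "F ((r(i := r i - 1))(i := Suc ((r(i := r i - 1)) i))) = F r"
      using r by simp
  qed (use raise in auto)
  finally show ?thesis .
qed

lemma lookup_bell_monomial:
  fixes N :: nat
  shows "Poly_Mapping.lookup (\<Sum>j = 1..N. Poly_Mapping.single j (int (r j))) i =
    (if i \<in> {1..N} then int (r i) else 0)"
  unfolding lookup_sum lookup_single when_def by (subst sum.delta) simp_all

lemma raise_monomial:
  fixes N :: nat
  assumes "i \<in> {1..N}"
  shows "(\<Sum>j = 1..N. Poly_Mapping.single j (int ((t(i := Suc (t i))) j))) =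
    (\<Sum>j = 1..N. Poly_Mapping.single j (int (t j))) + Poly_Mapping.single i 1"
proof (rule poly_mapping_eqI)
  fix l
  show "Poly_Mapping.lookup (\<Sum>j = 1..N. Poly_Mapping.single j (int ((t(i := Suc (t i))) j))) l =
    Poly_Mapping.lookup ((\<Sum>j = 1..N. Poly_Mapping.single j (int (t j))) + Poly_Mapping.single i 1) l"
    using assms unfolding lookup_add lookup_bell_monomial by (auto simp: lookup_single when_def)
qed

lemma raise_denominator:
  assumes "i \<in> {1..N}"
  shows "(\<Prod>j = 1..N. fact ((t(i := Suc (t i))) j) * fact j ^ (t(i := Suc (t i))) j :: 'a::field_char_0) =
    of_nat (Suc (t i)) * fact i * (\<Prod>j = 1..N. fact (t j) * fact j ^ t j)"
proof -
  have rest: "(\<Prod>j\<in>{1..N} - {i}. fact ((t(i := Suc (t i))) j) * fact j ^ (t(i := Suc (t i))) j :: 'a) =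
      (\<Prod>j\<in>{1..N} - {i}. fact (t j) * fact j ^ t j)"
    by (intro prod.cong) auto
  show ?thesis
    unfolding prod.remove[OF finite_atLeastAtMost assms] rest by (simp add: mult_ac)
qed

text \<open>Multiplication by \<open>X i\<close> adds a block of size i. The constant offsets the
  growth of the denominator, where r_i! gains t i + 1 and (i!)^(r_i) gains i!.\<close>

lemma X_mult_bell_weight:
  assumes "i \<in> {1..N}"
  shows "X i * bell_weight N t =
    Const (of_nat (Suc (t i)) * fact i) * (bell_weight N (t(i := Suc (t i))) :: 'a::field_char_0 laurent)"
  unfolding bell_weight_def raise_monomial[OF assms] raise_denominator[OF assms]
  \<comment> \<open>Characteristic zero allows cancelling the factor t i + 1.\<close>
  using of_nat_neq_0[of "t i", where ?'a = 'a]
  by (simp add: Xpow_def Const_def mult_single add_ac del: of_nat_Suc single_of_nat)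

text \<open>The exponent t i + 1 brought down by differentiation cancels its counterpart in the
  denominator; only 1 / i! survives.\<close>

lemma partial_deriv_bell_weight_raise:
  assumes "i \<in> {1..N}"
  shows "partial_deriv i (bell_weight N (t(i := Suc (t i)))) =
    Const (1 / fact i) * (bell_weight N t :: 'a::field_char_0 laurent)"
  unfolding bell_weight_def partial_deriv_single lookup_bell_monomial raise_denominator[OF assms]
  unfolding raise_monomial[OF assms]
  using assms of_nat_neq_0[of "t i", where ?'a = 'a]
  by (simp add: Const_def mult_single del: of_nat_Suc single_of_nat)

lemma partial_deriv_bell_weight_0:
  "r i = 0 \<Longrightarrow> partial_deriv i (bell_weight N r) = 0"
  unfolding bell_weight_def partial_deriv_single lookup_bell_monomial by simp

lemma vars_bell_weight: "vars (bell_weight N r) \<subseteq> {1..N}"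
proof -
  have "bell_weight N r \<in> laurent_ring {1..N} UNIV"
    by (auto simp: bell_weight_def laurent_ring_def in_keys_iff lookup_bell_monomial
        simp del: One_nat_def split: if_splits)
  then show ?thesis by (rule vars_subset)
qed

text \<open>Compare coefficients at a type r of total size n + 1. Adding a singleton contributes
  r_1; enlarging a block from size j to j + 1 contributes (j + 1) r_(j+1). Together this is the sum
  of i r_i, that is n + 1, which turns n! into (n + 1)!.\<close>

lemma bell_Suc_Suc:
  "(bell (Suc n) (Suc k) :: 'a::field_char_0 laurent) =
    X 1 * bell n k + total_deriv (bell n (Suc k))"
proof -
  \<comment> \<open>Level n + 1 accommodates the largest block that occurs on the left-hand
    side.\<close>
  define N where "N = Suc n"
  let ?w = "bell_weight N :: _ \<Rightarrow> 'a laurent"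
  let ?T = "type_index N (Suc n) (Suc k)"
  have first: "(\<Sum>s\<in>type_index N n k. X 1 * ?w s) = (\<Sum>r\<in>?T. Const (of_nat (r 1)) * ?w r)"
  proof -
    have 1: "1 \<in> {1..N}" by (simp add: N_def)
    have "(\<Sum>r\<in>type_index N (n + 1) (Suc k). Const (of_nat (r 1)) * ?w r) =
        (\<Sum>s\<in>type_index N n k. Const (of_nat ((s(1 := Suc (s 1))) 1)) * ?w (s(1 := Suc (s 1))))"
      by (rule sum_type_index_raise[OF 1]) simp
    then show ?thesis
      unfolding X_mult_bell_weight[OF 1] by simp
  qed
  have shift: "(\<Sum>s\<in>type_index N n (Suc k). X (Suc j) * partial_deriv j (?w s)) =
      (\<Sum>r\<in>?T. Const (of_nat (Suc j * r (Suc j))) * ?w r)" if j: "j \<in> {1..n}" for j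
  proof -
    \<comment> \<open>The size left after removing a block of size j. The types before and after
      enlarging the block both arise from a common t of size a.\<close>
    define a where "a = n - j"
    have n: "n = a + j" using j by (simp add: a_def)
    have jN: "j \<in> {1..N}" "Suc j \<in> {1..N}" using j by (auto simp: N_def)
    have "(\<Sum>s\<in>type_index N n (Suc k). X (Suc j) * partial_deriv j (?w s)) =
        (\<Sum>t\<in>type_index N a k. X (Suc j) * partial_deriv j (?w (t(j := Suc (t j)))))"
      unfolding n by (rule sum_type_index_raise[OF jN(1)]) (simp add: partial_deriv_bell_weight_0)
    also have "\<dots> = (\<Sum>t\<in>type_index N a k. Const (of_nat (Suc j * Suc (t (Suc j)))) *
        ?w (t(Suc j := Suc (t (Suc j)))))"
    proof (rule sum.cong[OF refl])
      fix t
      have "X (Suc j) * partial_deriv j (?w (t(j := Suc (t j)))) =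
          Const (1 / fact j) * (X (Suc j) * ?w t)"
        unfolding partial_deriv_bell_weight_raise[OF jN(1)] by (simp only: mult_ac)
      also have "\<dots> = Const (1 / fact j * (of_nat (Suc (t (Suc j))) * fact (Suc j))) *
          ?w (t(Suc j := Suc (t (Suc j))))"
        unfolding X_mult_bell_weight[OF jN(2)] by (simp only: Const_mult mult_ac)
      also have "1 / fact j * (of_nat (Suc (t (Suc j))) * fact (Suc j)) =
          (of_nat (Suc j * Suc (t (Suc j))) :: 'a)"
        by (simp only: fact_Suc of_nat_mult) simp
      finally show "X (Suc j) * partial_deriv j (?w (t(j := Suc (t j)))) =
          Const (of_nat (Suc j * Suc (t (Suc j)))) * ?w (t(Suc j := Suc (t (Suc j))))" .
    qed
    also have "\<dots> = (\<Sum>r\<in>?T. Const (of_nat (Suc j * r (Suc j))) * ?w r)"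
      using sum_type_index_raise[OF jN(2), of "\<lambda>r. Const (of_nat (Suc j * r (Suc j))) * ?w r" a k]
      by (simp add: n del: of_nat_Suc of_nat_mult mult_Suc mult_Suc_right)
    finally show ?thesis .
  qed
  have deriv: "total_deriv (?w s) = (\<Sum>j = 1..n. X (Suc j) * partial_deriv j (?w s))"
    if "s \<in> type_index N n (Suc k)" for s
  proof -
    \<comment> \<open>A type of size n has no block of size n + 1, so the term j = N drops
      out.\<close>
    have "s N = 0" using type_index_eq_0[OF that] by (simp add: N_def)
    then show ?thesis
      using total_deriv_superset[OF _ vars_bell_weight[of N s]]
      by (simp add: N_def partial_deriv_bell_weight_0)
  qed
  have "X 1 * bell n k + total_deriv (bell n (Suc k) :: 'a laurent) =
      Const (fact n) * ((\<Sum>s\<in>type_index N n k. X 1 * ?w s) +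
        (\<Sum>s\<in>type_index N n (Suc k). total_deriv (?w s)))"
    by (simp add: bell_eq_sum_weights[of n N] N_def total_deriv_mult total_deriv_sum
        sum_distrib_left distrib_left mult_ac)
  also have "(\<Sum>s\<in>type_index N n (Suc k). total_deriv (?w s)) =
      (\<Sum>j = 1..n. \<Sum>s\<in>type_index N n (Suc k). X (Suc j) * partial_deriv j (?w s))"
    by (simp add: deriv) (rule sum.swap)
  also have "\<dots> = (\<Sum>r\<in>?T. \<Sum>j = 1..n. Const (of_nat (Suc j * r (Suc j))) * ?w r)"
    by (simp add: shift del: of_nat_mult mult_Suc) (rule sum.swap)
  also have "(\<Sum>s\<in>type_index N n k. X 1 * ?w s) + \<dots> = (\<Sum>r\<in>?T. Const (of_nat (Suc n)) * ?w r)"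
    unfolding first sum.distrib[symmetric]
  proof (rule sum.cong[OF refl])
    fix r assume "r \<in> ?T"
    \<comment> \<open>The size condition on r evaluates the total coefficient.\<close>
    then have "Suc n = (\<Sum>j = 1..N. j * r j)" by (simp add: type_index_def)
    also have "\<dots> = r 1 + (\<Sum>j = 1..n. Suc j * r (Suc j))"
      unfolding N_def by (subst sum.atLeast_Suc_atMost)
        (simp_all add: sum.shift_bounds_cl_Suc_ivl del: sum.cl_ivl_Suc)
    finally have "Const (of_nat (Suc n)) = Const (of_nat (r 1)) +
        (\<Sum>j = 1..n. Const (of_nat (Suc j * r (Suc j))) :: 'a laurent)"
      unfolding Const_of_nat by (simp only: of_nat_add of_nat_sum)
    then show "Const (of_nat (r 1)) * ?w r + (\<Sum>j = 1..n. Const (of_nat (Suc j * r (Suc j))) * ?w r) =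
        Const (of_nat (Suc n)) * ?w r"
      by (simp only: distrib_right sum_distrib_right)
  qed
  also have "Const (fact n) * \<dots> = Const (fact (Suc n)) * (\<Sum>r\<in>?T. ?w r)"
    unfolding fact_Suc Const_mult by (simp add: sum_distrib_left mult_ac)
  also have "\<dots> = bell (Suc n) (Suc k)"
    by (simp add: bell_eq_sum_weights[of "Suc n" N] N_def)
  finally show ?thesis by simp
qed

section \<open>Reciprocal polynomials as iterated derivatives of 1 / X_0\<close>

lemma bell_0_right: "bell n 0 = (if n = 0 then 1 else 0)"
  by (simp add: bell_def)

lemma bell_eq_0: "n < k \<Longrightarrow> bell n k = 0"
  by (simp add: bell_def)

text \<open>\<open>recip_poly m\<close> is Faa di Bruno's formula for the m-th derivative of 1 /
  X_0: the coefficient of B_(m,i) is the i-th derivative of 1/x at X_0. Differentiating the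
  coefficients gives the X_1 part of the Bell recursion, differentiating the B_(m,i) the other
  part.\<close>

lemma recip_poly_Suc: "recip_poly (Suc m) = total_deriv (recip_poly m :: 'a::field_char_0 laurent)"
proof -
  define c :: "nat \<Rightarrow> 'a laurent" where
    "c i = Const ((-1) ^ i * fact i) * Xpow 0 (- int (i + 1))" for i
  have c_deriv: "total_deriv (c i) = c (Suc i) * X 1" for i
  proof -
    have "total_deriv (c i) =
        Const ((-1) ^ i * fact i) * Const (of_int (- int (i + 1))) * X 1 * Xpow 0 (- int (Suc i + 1))"
      by (simp add: c_def total_deriv_mult total_deriv_Xpow mult_ac diff_diff_eq)
    also have "Const ((-1) ^ i * fact i) * Const (of_int (- int (i + 1))) =
        (Const ((-1) ^ Suc i * fact (Suc i)) :: 'a laurent)"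
      unfolding Const_mult[symmetric] by (simp add: algebra_simps)
    finally show ?thesis by (simp only: c_def mult_ac)
  qed
  have recip: "recip_poly m = (\<Sum>i = 0..m. c i * bell m i)" for m
    by (simp add: recip_poly_def c_def)
  let ?h = "\<lambda>i. c i * total_deriv (bell m i)"
  \<comment> \<open>The index can be shifted by one: B_(m,m+1) is 0 and B_(m,0) is constant, so
    neither boundary term contributes.\<close>
  have "(\<Sum>i = 0..m. ?h i) = (\<Sum>i = 0..Suc m. ?h i)"
    by (simp add: bell_eq_0)
  also have "\<dots> = (\<Sum>i = 0..m. ?h (Suc i))"
    by (subst sum.atLeast0_atMost_Suc_shift) (simp add: bell_0_right)
  finally have "total_deriv (recip_poly m) =
      (\<Sum>i = 0..m. c (Suc i) * (X 1 * bell m i + total_deriv (bell m (Suc i))))"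
    by (simp add: recip total_deriv_sum total_deriv_mult c_deriv sum.distrib distrib_left mult.assoc)
  also have "\<dots> = recip_poly (Suc m)"
    unfolding recip bell_Suc_Suc[symmetric]
    by (subst sum.atLeast0_atMost_Suc_shift) (simp add: bell_0_right)
  finally show ?thesis by simp
qed

section \<open>Images of the Bell polynomials and their inverse relation with Comtet's
  polynomials\<close>

text \<open>The shift i - 1 encodes the replacement of X_(j+1) by the j-th reciprocal polynomial;
  \<open>bell\<close> and \<open>bell_inverse\<close> involve only X_1, X_2, ..., where the
  subtraction is exact.\<close>

definition recip_subst :: "'a::field_char_0 laurent \<Rightarrow> 'a laurent" where
  "recip_subst = laurent_subst (\<lambda>i. recip_poly (i - 1))"

text \<open>By \<open>recip_poly_Suc\<close> the substitution commutes with the derivation on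
  indices from 1 on, so it carries over the recursion \<open>bell_Suc_Suc\<close>.\<close>

lemma recip_subst_bell_Suc_Suc:
  "recip_subst (bell (Suc n) (Suc k)) =
    recip_poly 0 * recip_subst (bell n k) + total_deriv (recip_subst (bell n (Suc k)))"
proof -
  let ?f = "\<lambda>i. recip_poly (i - 1) :: 'a laurent"
  have "laurent_subst ?f (total_deriv (bell n (Suc k))) = total_deriv (laurent_subst ?f (bell n (Suc k)))"
  proof (rule laurent_subst_total_deriv[OF bell_in_laurent_ring])
    fix i :: nat assume "i \<ge> 1"
    then show "recip_poly (Suc i - 1) = total_deriv (recip_poly (i - 1) :: 'a laurent)"
      by (cases i) (simp_all add: recip_poly_Suc)
  qed
  moreover have "laurent_subst ?f (X 1 * bell n k) = ?f 1 * laurent_subst ?f (bell n k)"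
    by (subst laurent_subst_mult[OF laurent_ring_Xpow bell_in_laurent_ring[where W = "{}"]]) simp_all
  ultimately show ?thesis
    by (simp add: recip_subst_def bell_Suc_Suc laurent_subst_add)
qed

lemma recip_subst_bell_0_right: "recip_subst (bell n 0) = (if n = 0 then 1 else 0)"
  by (simp add: recip_subst_def bell_0_right)

lemma recip_subst_bell_eq_0: "n < k \<Longrightarrow> recip_subst (bell n k) = 0"
  by (simp add: recip_subst_def bell_eq_0)

text \<open>B_(k,k) = X_1^k goes to the k-th power of 1 / X_0. This makes the diagonal of the
  triangular system cancellable.\<close>

lemma recip_subst_bell_diag: "recip_subst (bell k k) * X 0 ^ k = (1 :: 'a::field_char_0 laurent)"
proof -
  have "recip_subst (bell k k) = (recip_poly 0 ^ k :: 'a laurent)"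
    unfolding recip_subst_def bell_diag X_power[symmetric]
    by (subst laurent_subst_power[of _ "{1}"]) (simp_all add: laurent_ring_Xpow)
  then show ?thesis by (simp add: recip_poly_0_unit flip: power_mult_distrib)
qed

text \<open>Inserting both recursions produces the sum for (n, k - 1) and, by the Leibniz rule, the
  derivative of the sum for (n, k). The latter sum is constant by induction; hence k is arbitrary in
  the hypothesis.\<close>

lemma comtet_recip_subst_bell:
  "(\<Sum>j = 0..n. comtet n j * recip_subst (bell j k)) =
    (if n = k then 1 else 0 :: 'a::field_char_0 laurent)"
proof (induction n arbitrary: k)
  case 0
  then show ?case
    by (cases "k = 0") (simp_all add: recip_subst_bell_0_right recip_subst_bell_eq_0)
next
  case (Suc n)
  let ?b = "\<lambda>j k. recip_subst (bell j k) :: 'a laurent"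
  show ?case
  proof (cases k)
    case 0
    have "comtet (Suc n) j * ?b j 0 = 0" for j
      by (cases j) (simp_all add: recip_subst_bell_0_right)
    then show ?thesis using 0 by (simp only: sum.neutral_const) simp
  next
    case (Suc l)
    let ?h = "\<lambda>j. total_deriv (comtet n j) * ?b j (Suc l)"
    \<comment> \<open>The boundary terms vanish: C_(n,0) is constant and C_(n,n+1) is 0. The shift
      aligns the two halves of the Leibniz rule.\<close>
    have "(\<Sum>j = 0..n. ?h (Suc j)) = (\<Sum>j = 0..Suc n. ?h j)"
      by (subst sum.atLeast0_atMost_Suc_shift) (simp add: comtet_0_right)
    also have "\<dots> = (\<Sum>j = 0..n. ?h j)"
      by (simp add: comtet_eq_0)
    finally have h: "(\<Sum>j = 0..n. ?h (Suc j)) = (\<Sum>j = 0..n. ?h j)" .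
    have "(\<Sum>j = 0..Suc n. comtet (Suc n) j * ?b j (Suc l)) =
        (\<Sum>j = 0..n. comtet (Suc n) (Suc j) * ?b (Suc j) (Suc l))"
      by (subst sum.atLeast0_atMost_Suc_shift) simp
    also have "\<dots> = X 0 * ((\<Sum>j = 0..n. comtet n j * ?b (Suc j) (Suc l)) + (\<Sum>j = 0..n. ?h (Suc j)))"
      unfolding comtet_Suc_Suc
      by (simp add: sum_distrib_left distrib_left distrib_right sum.distrib mult.assoc)
    also have "\<dots> = recip_poly 0 * X 0 * (\<Sum>j = 0..n. comtet n j * ?b j l) +
        X 0 * total_deriv (\<Sum>j = 0..n. comtet n j * ?b j (Suc l))"
      unfolding h
      unfolding recip_subst_bell_Suc_Suc total_deriv_sum total_deriv_mult
      by (simp add: sum_distrib_left distrib_left sum.distrib mult_ac add_ac)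
    \<comment> \<open>The derivative of the constant is 0, and the prefactor of the first sum is
      1.\<close>
    also have "\<dots> = (if n = l then 1 else 0)"
      by (simp add: Suc.IH recip_poly_0_unit)
    finally show ?thesis using Suc by simp
  qed
qed

section \<open>Comparison of the two solutions of the triangular system\<close>

text \<open>In \<open>bell_inverse\<close> only X_1 may have negative exponents, and it goes to
  \<open>recip_poly 0\<close>, a unit with inverse X_0. The substitution is therefore multiplicative
  on the defining relation.\<close>

lemma recip_subst_bell_inverse:
  assumes "k \<le> n"
  shows "(\<Sum>j = k..n. recip_subst (bell_inverse n j) * recip_subst (bell j k)) =
    (if n = k then 1 else 0 :: 'a::field_char_0 laurent)"
proof -
  let ?f = "\<lambda>i. recip_poly (i - 1) :: 'a laurent"
  have A: "is_bell_inverse (bell_inverse :: _ \<Rightarrow> _ \<Rightarrow> 'a laurent)"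
    by (rule is_bell_inverse_bell_inverse)
  have unit: "?f i dvd 1" if "i \<in> {1}" for i
    using that by (simp add: dvdI[OF recip_poly_0_unit[symmetric]])
  have mult: "recip_subst (bell_inverse n j * bell j k) =
      recip_subst (bell_inverse n j) * (recip_subst (bell j k) :: 'a laurent)" for j
    unfolding recip_subst_def
    using A unit
    by (intro laurent_subst_mult[OF _ bell_in_laurent_ring]) (auto simp: is_bell_inverse_def)
  have "recip_subst (\<Sum>j = k..n. bell_inverse n j * bell j k) =
      (\<Sum>j = k..n. recip_subst (bell_inverse n j) * (recip_subst (bell j k) :: 'a laurent))"
    unfolding mult[symmetric] by (simp only: recip_subst_def laurent_subst_sum)
  moreover have "(\<Sum>j = k..n. bell_inverse n j * bell j k) = (if n = k then 1 else 0 :: 'a laurent)"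
    using A assms by (simp add: is_bell_inverse_def)
  ultimately show ?thesis by (simp add: recip_subst_def split: if_splits)
qed

theorem theorem5p22:
  fixes n k :: nat
  assumes "k \<le> n"
  shows "(comtet n k :: 'a::field_char_0 laurent) =
    laurent_subst (\<lambda>i. recip_poly (i - 1)) (bell_inverse n k)"
proof -
  let ?b = "\<lambda>j k. recip_subst (bell j k) :: 'a laurent"
  have "comtet n k = (recip_subst (bell_inverse n k) :: 'a laurent)" if "k \<le> n" for k
    using that
  \<comment> \<open>Downward induction on k from the diagonal: the equation for k involves only
    entries with j at least k.\<close>
  proof (induction "n - k" arbitrary: k rule: less_induct)
    case less
    \<comment> \<open>Terms with j < k vanish, so the sum over all j may be used.\<close>
    have "(\<Sum>j = k..n. comtet n j * ?b j k) = (\<Sum>j = 0..n. comtet n j * ?b j k)"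
      by (intro sum.mono_neutral_left) (auto simp: recip_subst_bell_eq_0)
    also have "\<dots> = (\<Sum>j = k..n. recip_subst (bell_inverse n j) * ?b j k)"
      using less.prems by (simp add: comtet_recip_subst_bell recip_subst_bell_inverse)
    finally have "comtet n k * ?b k k + (\<Sum>j \<in> {k<..n}. comtet n j * ?b j k) =
        recip_subst (bell_inverse n k) * ?b k k +
        (\<Sum>j \<in> {k<..n}. recip_subst (bell_inverse n j) * ?b j k)"
      using less.prems by (simp add: sum.head)
    moreover have "(\<Sum>j \<in> {k<..n}. comtet n j * ?b j k) =
        (\<Sum>j \<in> {k<..n}. recip_subst (bell_inverse n j) * ?b j k)"
      using less by (intro sum.cong) auto
    \<comment> \<open>Only the diagonal terms remain; the factor \<open>X 0 ^ k\<close> inverts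
      \<open>?b k k\<close>.\<close>
    ultimately have "comtet n k * ?b k k * X 0 ^ k = recip_subst (bell_inverse n k) * ?b k k * X 0 ^ k"
      by simp
    then show ?case by (simp add: mult.assoc recip_subst_bell_diag)
  qed
  then show ?thesis using assms by (simp add: recip_subst_def)
qed

end
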